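(* Let $A$ be a nonempty set, let $B$ be an abelian group with operators in $A$, and let $C$ be an abelian group with operators in $A$ and in $B$ (groups written additively). Let $\sigma_B,\delta_B\colon B\to B$ and $\sigma_C,\delta_C\colon C\to C$ be additive maps. Suppose that $(A,B,C)$ is associative, that $\delta_C$ is a $\delta_B$-twisted $\sigma_B$-derivation, and that $\sigma_C$ is $\sigma_B$-twisted. Then $(A[x],\,B[x;\sigma_B,\delta_B],\,C[x;\sigma_C,\delta_C])$ is associative.
   Context: $\mathbb{N}=\{0,1,2,\ldots\}$. An abelian group $G$ has operators in a set $S$ if each $s\in S$ acts on $G$ (written $g\mapsto sg$) as a group endomorphism: $s(g+h)=sg+sh$. The operator sets are assumed to have a fixed zero element: there is $0\in A$ acting as the zero map on $B$ and on $C$, and the identity element $0\in B$ acts as the zero map on $C$. $A[x]$ is the set of formal sums $\sum_{i\in\mathbb{N}}a_ix^i$ with $a_i\in A$ and $a_i=0$ for all but finitely many $i$; $B[x]$ and $C[x]$ are defined likewise and are abelian groups under coefficientwise addition. Given an abelian group $G$ with operators in a set $S$ and additive maps $\sigma_G,\delta_G\colon G\to G$, let $\pi^i_j\colon G\to G$ (for $i\ge j$) be the sum of all $\binom{i}{j}$ compositions of $j$ instances of $\sigma_G$ and $i-j$ instances of $\delta_G$, and $\pi^i_j=0$ if $i<j$. The Ore group extension $G[x;\sigma_G,\delta_G]$ is the abelian group $G[x]$ with $S[x]$ as set of operators, the action being $$\Bigl(\sum_{i}s_ix^i\Bigr)\Bigl(\sum_{j}g_jx^j\Bigr)=\sum_{i,j,k\in\mathbb{N}}\bigl(s_i\,\pi_k^i(g_j)\bigr)x^{k+j}.$$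 Thus $A[x]$ acts on $B[x;\sigma_B,\delta_B]$ and on $C[x;\sigma_C,\delta_C]$, and the set $B[x;\sigma_B,\delta_B]=B[x]$ acts on $C[x;\sigma_C,\delta_C]$. $\sigma_C$ is $\sigma_B$-twisted if $\sigma_C(bc)=\sigma_B(b)\sigma_C(c)$ for all $b\in B$, $c\in C$. $\delta_C$ is a $\delta_B$-twisted $\sigma_B$-derivation if $\delta_C(bc)=\sigma_B(b)\delta_C(c)+\delta_B(b)c$ for all $b\in B$, $c\in C$. A triple $(X,Y,Z)$, where $Y$ is an abelian group with operators in $X$ and $Z$ is an abelian group with operators in $X$ and in $Y$, is associative if $(uv)w=u(vw)$ for all $u\in X$, $v\in Y$, $w\in Z$.
   Formalization: The formal theorem additionally assumes that the action of B on C is additive in B, i.e. (b+b')c = bc+b'c for all b, b' in B and c in C; without this the statement is false (e.g. b acting on the integers as multiplication by b^2). *)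

theory Defs
  imports "HOL-Computational_Algebra.Polynomial" "HOL-Library.Groups_Big_Fun"
begin

text \<open>
  For a type \<open>'s\<close> with a distinguished zero, the type \<open>'s poly\<close> consists of
  the finitely supported sequences in \<open>'s\<close>, so it serves as the set \<open>S[x]\<close> even when
  \<open>'s\<close> carries no addition; \<open>monom s i\<close> is \<open>s x^i\<close>.
\<close>

definition has_operators :: "('s::zero \<Rightarrow> 'g::ab_group_add \<Rightarrow> 'g) \<Rightarrow> bool" where
  "has_operators act \<longleftrightarrow> (\<forall>s. additive (act s)) \<and> (\<forall>g. act 0 g = 0)"

text \<open>
  \<open>has_operators act\<close> says nothing about \<open>act (s + t)\<close> when the operators themselves form a
  group. For the action of \<open>B\<close> on \<open>C\<close> the theorem therefore assumes \<open>(b + b') c = b c + b' c\<close>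
  separately, and cannot do without it: let \<open>B = C\<close> be the integers with \<open>b\<close> acting on \<open>C\<close> as
  multiplication by \<open>b^2\<close>, let \<open>A = {0, 1}\<close> act by multiplication, let both \<open>\<sigma>\<close> be the identity
  and both \<open>\<delta>\<close> zero. All other hypotheses hold, but for \<open>u = v = 1 + x\<close> and \<open>w = 1\<close> one has
  \<open>(u v) w = 1 + 4 x + x^2\<close> and \<open>u (v w) = 1 + 2 x + x^2\<close>.
\<close>

definition associative_triple ::
    "('a \<Rightarrow> 'b \<Rightarrow> 'b) \<Rightarrow> ('a \<Rightarrow> 'c \<Rightarrow> 'c) \<Rightarrow> ('b \<Rightarrow> 'c \<Rightarrow> 'c) \<Rightarrow> bool" where
  "associative_triple AB AC BC \<longleftrightarrow> (\<forall>u v w. BC (AB u v) w = AC u (BC v w))"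

definition twisted ::
    "('b \<Rightarrow> 'c \<Rightarrow> 'c) \<Rightarrow> ('b \<Rightarrow> 'b) \<Rightarrow> ('c \<Rightarrow> 'c) \<Rightarrow> bool" where
  "twisted BC \<sigma>B \<sigma>C \<longleftrightarrow> (\<forall>b c. \<sigma>C (BC b c) = BC (\<sigma>B b) (\<sigma>C c))"

definition twisted_derivation ::
    "('b \<Rightarrow> 'c \<Rightarrow> 'c::ab_group_add) \<Rightarrow> ('b \<Rightarrow> 'b) \<Rightarrow> ('b \<Rightarrow> 'b) \<Rightarrow> ('c \<Rightarrow> 'c) \<Rightarrow> bool" where
  "twisted_derivation BC \<sigma>B \<delta>B \<delta>C \<longleftrightarrow>
     (\<forall>b c. \<delta>C (BC b c) = BC (\<sigma>B b) (\<delta>C c) + BC (\<delta>B b) c)"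

text \<open>
  The compositions of \<open>j\<close> instances of \<open>\<sigma>\<close> and \<open>i - j\<close> instances of \<open>\<delta>\<close> are indexed by the
  boolean words of length \<open>i\<close> with exactly \<open>j\<close> entries \<open>True\<close>, so that coinciding compositions
  are counted with multiplicity. There is no such word if \<open>i < j\<close>, and the sum is then zero.
\<close>

definition ore_pi ::
    "('g \<Rightarrow> 'g) \<Rightarrow> ('g \<Rightarrow> 'g) \<Rightarrow> nat \<Rightarrow> nat \<Rightarrow> 'g::ab_group_add \<Rightarrow> 'g" where
  "ore_pi \<sigma> \<delta> i j g =
     (\<Sum>w | length w = i \<and> count_list w True = j. foldr (\<lambda>b. if b then \<sigma> else \<delta>) w g)"

text \<open>
  \<open>Sum_any\<close> sums a function of finite support (and would be zero for infinite support); that the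
  support is finite here is \<open>finite_ore_action_support\<close> below.
\<close>

definition ore_action ::
    "('s::zero \<Rightarrow> 'g::ab_group_add \<Rightarrow> 'g) \<Rightarrow> ('g \<Rightarrow> 'g) \<Rightarrow> ('g \<Rightarrow> 'g) \<Rightarrow>
      's poly \<Rightarrow> 'g poly \<Rightarrow> 'g poly" where
  "ore_action act \<sigma> \<delta> p q =
     Sum_any (\<lambda>(i, j, k). monom (act (coeff p i) (ore_pi \<sigma> \<delta> i k (coeff q j))) (k + j))"

lemma finite_ore_words: "finite {w :: bool list. length w = i \<and> count_list w True = j}"
  by (rule finite_subset[OF _ finite_lists_length_eq[of "UNIV :: bool set" i]]) auto

lemma card_ore_words: "card {w :: bool list. length w = i \<and> count_list w True = j} = i choose j"
proof (induction i arbitrary: j)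
  case 0
  have "{w :: bool list. length w = 0 \<and> count_list w True = j} = (if j = 0 then {[]} else {})"
    by auto
  then show ?case by (cases j) auto
next
  case (Suc i)
  let ?W = "\<lambda>i j. {w :: bool list. length w = i \<and> count_list w True = j}"
  show ?case
  proof (cases j)
    case 0
    have "?W (Suc i) 0 = (#) False ` ?W i 0"
      by (auto simp: length_Suc_conv image_iff split: if_splits)
    with Suc.IH[of 0] 0 show ?thesis by (simp add: card_image)
  next
    case (Suc j')
    have "?W (Suc i) (Suc j') = (#) True ` ?W i j' \<union> (#) False ` ?W i (Suc j')"
      by (auto simp: length_Suc_conv image_iff split: if_splits)
    moreover have "(#) True ` ?W i j' \<inter> (#) False ` ?W i (Suc j') = {}" by auto
    ultimately show ?thesis
      using Suc.IH[of j'] Suc.IH[of "Suc j'"] Suc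
      by (simp add: card_Un_disjoint finite_ore_words card_image)
  qed
qed

lemma ore_pi_eq_0: "i < j \<Longrightarrow> ore_pi \<sigma> \<delta> i j g = 0"
proof -
  assume "i < j"
  then have "{w :: bool list. length w = i \<and> count_list w True = j} = {}"
    using count_le_length[of _ True] by (auto simp: not_le[symmetric])
  then show ?thesis unfolding ore_pi_def by (simp only: sum.empty)
qed

lemma additive_ore_pi:
  assumes "additive \<sigma>" "additive \<delta>"
  shows "additive (ore_pi \<sigma> \<delta> i j)"
proof
  fix g h
  have "foldr (\<lambda>b. if b then \<sigma> else \<delta>) w (g + h) =
      foldr (\<lambda>b. if b then \<sigma> else \<delta>) w g + foldr (\<lambda>b. if b then \<sigma> else \<delta>) w h" for w
    by (induction w) (auto simp: additive.add[OF assms(1)] additive.add[OF assms(2)])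
  then show "ore_pi \<sigma> \<delta> i j (g + h) = ore_pi \<sigma> \<delta> i j g + ore_pi \<sigma> \<delta> i j h"
    by (simp add: ore_pi_def sum.distrib)
qed

lemma ore_action_support:
  assumes "has_operators act" "additive \<sigma>" "additive \<delta>" "degree p \<le> m" "degree q \<le> n"
  shows "{t. (case t of (i, j, k) \<Rightarrow>
            monom (act (coeff p i) (ore_pi \<sigma> \<delta> i k (coeff q j))) (k + j)) \<noteq> 0}
         \<subseteq> {..m} \<times> {..n} \<times> {..m}"
proof -
  have z: "act s 0 = 0" "act 0 g = 0" for s g
    using assms(1) additive.zero by (auto simp: has_operators_def)
  have *: "act (coeff p i) (ore_pi \<sigma> \<delta> i k (coeff q j)) = 0" if "m < i \<or> n < j \<or> i < k" for i j k
    using that assms(4,5)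
    by (auto simp: z coeff_eq_0 ore_pi_eq_0 additive.zero[OF additive_ore_pi[OF assms(2,3)]])
  show ?thesis
  proof
    fix t :: "nat \<times> nat \<times> nat"
    obtain i j k where t: "t = (i, j, k)" by (cases t)
    assume "t \<in> {t. (case t of (i, j, k) \<Rightarrow>
            monom (act (coeff p i) (ore_pi \<sigma> \<delta> i k (coeff q j))) (k + j)) \<noteq> 0}"
    then have "\<not> (m < i \<or> n < j \<or> i < k)" using *[of i j k] by (auto simp: t)
    then show "t \<in> {..m} \<times> {..n} \<times> {..m}" by (auto simp: t)
  qed
qed

lemma finite_ore_action_support:
  assumes "has_operators act" "additive \<sigma>" "additive \<delta>"
  shows "finite {t. (case t of (i, j, k) \<Rightarrow>
            monom (act (coeff p i) (ore_pi \<sigma> \<delta> i k (coeff q j))) (k + j)) \<noteq> 0}"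
  by (rule finite_subset[OF ore_action_support[OF assms order.refl order.refl]]) simp

lemma ore_action_eq_sum:
  assumes "has_operators act" "additive \<sigma>" "additive \<delta>" "degree p \<le> m" "degree q \<le> n"
  shows "ore_action act \<sigma> \<delta> p q =
    (\<Sum>i\<le>m. \<Sum>j\<le>n. \<Sum>k\<le>m. monom (act (coeff p i) (ore_pi \<sigma> \<delta> i k (coeff q j))) (k + j))"
  unfolding ore_action_def
  by (subst Sum_any.expand_superset[OF _ ore_action_support[OF assms]])
     (simp_all add: sum.cartesian_product[symmetric])

lemma has_operators_ore_action:
  assumes "has_operators act" "additive \<sigma>" "additive \<delta>"
  shows "has_operators (ore_action act \<sigma> \<delta>)"
  unfolding has_operators_def
proof (intro conjI allI)
  fix p
  show "additive (ore_action act \<sigma> \<delta> p)"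
  proof
    fix q r :: "'b poly"
    define n where "n = max (degree q) (degree r)"
    have act: "act s (g + h) = act s g + act s h" for s g h
      using assms(1) additive.add by (auto simp: has_operators_def)
    have "degree (q + r) \<le> n" "degree q \<le> n" "degree r \<le> n"
      by (auto simp: n_def degree_add_le_max)
    then show "ore_action act \<sigma> \<delta> p (q + r) = ore_action act \<sigma> \<delta> p q + ore_action act \<sigma> \<delta> p r"
      by (simp add: ore_action_eq_sum[OF assms order.refl] act sum.distrib add_monom[symmetric]
            additive.add[OF additive_ore_pi[OF assms(2,3)]])
  qed
next
  fix q
  show "ore_action act \<sigma> \<delta> 0 q = 0"
    using assms(1) by (simp add: ore_action_eq_sum[OF assms order.refl order.refl] has_operators_def)
qed

end

theory Submission
  imports Defs
begin

text \<open>
  Let \<open>X\<close> be the action of the indeterminate on an Ore group extension. A polynomial \<open>p\<close> acts as the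
  sum over \<open>i\<close> of its coefficient \<open>p\<^sub>i\<close> acting coefficientwise after \<open>X\<close> to the power \<open>i\<close>. The two
  twisting hypotheses give \<open>X (v w) = (X v) w\<close>, and associativity of \<open>(A, B, C)\<close> gives
  \<open>a (v w) = (a v) w\<close> for \<open>a \<in> A\<close>. Combining the two and summing over the coefficients of \<open>u\<close> yields
  \<open>u (v w) = (u v) w\<close>. Additivity of the action of \<open>B\<close> in its operator enters twice: \<open>X v\<close> and \<open>u v\<close>
  are sums that act on \<open>w\<close>.
\<close>

lemma degree_map_poly_additive_le:
  assumes "additive f"
  shows "degree (map_poly f p) \<le> degree p"
  by (rule degree_le) (simp add: coeff_map_poly additive.zero[OF assms] coeff_eq_0)

lemma map_poly_sum:
  assumes "additive f"
  shows "map_poly f (sum p I) = (\<Sum>i\<in>I. map_poly f (p i))"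
  by (rule poly_eqI)
     (simp add: coeff_map_poly coeff_sum additive.zero[OF assms] additive.sum[OF assms])

lemma ore_pi_0: "ore_pi \<sigma> \<delta> 0 k g = (if k = 0 then g else 0)"
proof -
  have "{w :: bool list. length w = 0 \<and> count_list w True = k} = (if k = 0 then {[]} else {})"
    by auto
  then show ?thesis unfolding ore_pi_def by (simp del: length_0_conv)
qed

lemma ore_pi_Suc_0:
  assumes "additive \<delta>"
  shows "ore_pi \<sigma> \<delta> (Suc i) 0 g = \<delta> (ore_pi \<sigma> \<delta> i 0 g)"
proof -
  have "{w :: bool list. length w = Suc i \<and> count_list w True = 0}
      = (#) False ` {w. length w = i \<and> count_list w True = 0}"
    by (auto simp: length_Suc_conv image_iff split: if_splits)
  then show ?thesis
    unfolding ore_pi_def by (simp add: sum.reindex additive.sum[OF assms])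
qed

text \<open>A Pascal rule: words are split by their first letter, the map that \<open>foldr\<close>
  applies last, and additivity pulls that map out of the sum.\<close>

lemma ore_pi_Suc_Suc:
  assumes "additive \<sigma>" "additive \<delta>"
  shows "ore_pi \<sigma> \<delta> (Suc i) (Suc k) g = \<sigma> (ore_pi \<sigma> \<delta> i k g) + \<delta> (ore_pi \<sigma> \<delta> i (Suc k) g)"
proof -
  have "{w :: bool list. length w = Suc i \<and> count_list w True = Suc k}
      = (#) True ` {w. length w = i \<and> count_list w True = k}
        \<union> (#) False ` {w. length w = i \<and> count_list w True = Suc k}"
    by (auto simp: length_Suc_conv image_iff split: if_splits)
  moreover have "(#) True ` {w. length w = i \<and> count_list w True = k}
      \<inter> (#) False ` {w. length w = i \<and> count_list w True = Suc k} = {}"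
    by auto
  ultimately show ?thesis
    unfolding ore_pi_def
    by (simp add: sum.union_disjoint finite_ore_words sum.reindex
        additive.sum[OF assms(1)] additive.sum[OF assms(2)])
qed

text \<open>The rule \<open>x g = \<sigma>(g) x + \<delta>(g)\<close>, stated on the group alone: no
  operator need act as the identity, so \<open>x\<close> itself need not be an operator.\<close>

definition ore_shift :: "('g \<Rightarrow> 'g) \<Rightarrow> ('g \<Rightarrow> 'g) \<Rightarrow> 'g poly \<Rightarrow> 'g::ab_group_add poly" where
  "ore_shift \<sigma> \<delta> q = pCons 0 (map_poly \<sigma> q) + map_poly \<delta> q"

lemma coeff_ore_shift_0:
  assumes "additive \<delta>"
  shows "coeff (ore_shift \<sigma> \<delta> q) 0 = \<delta> (coeff q 0)"
  by (simp add: ore_shift_def coeff_map_poly additive.zero[OF assms])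

lemma coeff_ore_shift_Suc:
  assumes "additive \<sigma>" "additive \<delta>"
  shows "coeff (ore_shift \<sigma> \<delta> q) (Suc n) = \<sigma> (coeff q n) + \<delta> (coeff q (Suc n))"
  by (simp add: ore_shift_def coeff_map_poly additive.zero[OF assms(1)] additive.zero[OF assms(2)])

lemma ore_shift_sum:
  assumes "additive \<sigma>" "additive \<delta>"
  shows "ore_shift \<sigma> \<delta> (sum q I) = (\<Sum>i\<in>I. ore_shift \<sigma> \<delta> (q i))"
proof (rule poly_eqI)
  fix n
  show "coeff (ore_shift \<sigma> \<delta> (sum q I)) n = coeff (\<Sum>i\<in>I. ore_shift \<sigma> \<delta> (q i)) n"
    by (cases n) (simp_all add: coeff_sum coeff_ore_shift_0 coeff_ore_shift_Suc assms sum.distrib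
        additive.sum[OF assms(1)] additive.sum[OF assms(2)])
qed

lemma coeff_ore_shift_power:
  assumes "additive \<sigma>" "additive \<delta>"
  shows "coeff ((ore_shift \<sigma> \<delta> ^^ i) q) n = (\<Sum>k\<le>n. ore_pi \<sigma> \<delta> i k (coeff q (n - k)))"
proof (induction i arbitrary: n)
  case 0
  show ?case by (simp add: ore_pi_0)
next
  case (Suc i)
  show ?case
  proof (cases n)
    case 0
    then show ?thesis
      using Suc.IH[of 0] by (simp add: coeff_ore_shift_0 assms ore_pi_Suc_0)
  next
    case (Suc n')
    have "coeff ((ore_shift \<sigma> \<delta> ^^ Suc i) q) (Suc n')
        = (\<Sum>k\<le>n'. \<sigma> (ore_pi \<sigma> \<delta> i k (coeff q (n' - k))))
          + (\<Sum>k\<le>Suc n'. \<delta> (ore_pi \<sigma> \<delta> i k (coeff q (Suc n' - k))))"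
      by (simp add: coeff_ore_shift_Suc assms Suc.IH
          additive.sum[OF assms(1)] additive.sum[OF assms(2)] del: sum.atMost_Suc)
    \<comment> \<open>The \<open>\<sigma>\<close> terms move from \<open>k\<close> to
      \<open>k + 1\<close>, where they pair with the \<open>\<delta>\<close> terms by the Pascal
      rule; at \<open>k = 0\<close> only \<open>\<delta>\<close> occurs.\<close>
    also have "\<dots> = (\<Sum>k\<le>Suc n'. ore_pi \<sigma> \<delta> (Suc i) k (coeff q (Suc n' - k)))"
      by (simp add: sum.atMost_Suc_shift ore_pi_Suc_0 ore_pi_Suc_Suc assms sum.distrib
          del: sum.atMost_Suc)
    finally show ?thesis by (simp only: Suc)
  qed
qed

text \<open>The triple sum is grouped by \<open>i\<close>. The bound \<open>m\<close> is left free
  so that the actions of several polynomials can be expanded over one range.\<close>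

lemma ore_action_eq_shift:
  assumes act: "has_operators act" and add: "additive \<sigma>" "additive \<delta>" and deg: "degree p \<le> m"
  shows "ore_action act \<sigma> \<delta> p q
    = (\<Sum>i\<le>m. map_poly (act (coeff p i)) ((ore_shift \<sigma> \<delta> ^^ i) q))"
proof (rule poly_eqI)
  fix n
  \<comment> \<open>One bound must serve both \<open>i\<close> and \<open>k\<close>; with
    \<open>M\<close> and \<open>N\<close> at least \<open>n\<close>, every pair \<open>k\<close>,
    \<open>n - k\<close> with \<open>k \<le> n\<close> is in range.\<close>
  define M where "M = max m n"
  define N where "N = max (degree q) n"
  have addact: "additive (act s)" and act0: "act 0 g = 0" for s g
    using act by (auto simp: has_operators_def)
  define f where "f i k = act (coeff p i) (ore_pi \<sigma> \<delta> i k (coeff q (n - k)))" for i k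
  have inner: "(\<Sum>j\<le>N. \<Sum>k\<le>M.
      coeff (monom (act (coeff p i) (ore_pi \<sigma> \<delta> i k (coeff q j))) (k + j)) n) = (\<Sum>k\<le>n. f i k)" for i
  proof -
    \<comment> \<open>For each \<open>k\<close> only \<open>j = n - k\<close> reaches degree
      \<open>n\<close>; the guard \<open>k \<le> n\<close> is there because subtraction
      truncates.\<close>
    have "(\<Sum>j\<le>N. \<Sum>k\<le>M.
        coeff (monom (act (coeff p i) (ore_pi \<sigma> \<delta> i k (coeff q j))) (k + j)) n)
      = (\<Sum>k\<le>M. \<Sum>j\<le>N. if k \<le> n \<and> j = n - k then f i k else 0)"
      by (subst sum.swap) (auto simp: f_def intro!: sum.cong)
    also have "\<dots> = (\<Sum>k\<le>M. if k \<le> n then f i k else 0)"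
      by (intro sum.cong refl) (auto simp: N_def)
    also have "\<dots> = (\<Sum>k\<le>n. f i k)"
      by (rule sum.mono_neutral_cong_right) (auto simp: M_def)
    finally show ?thesis .
  qed
  have "coeff (ore_action act \<sigma> \<delta> p q) n = (\<Sum>i\<le>M. \<Sum>k\<le>n. f i k)"
    using deg by (subst ore_action_eq_sum[OF act add, of p M q N])
      (simp_all add: M_def N_def coeff_sum inner[unfolded M_def N_def] del: coeff_monom)
  also have "\<dots> = (\<Sum>i\<le>m. \<Sum>k\<le>n. f i k)"
    using deg by (intro sum.mono_neutral_right) (auto simp: M_def f_def coeff_eq_0 act0)
  finally show "coeff (ore_action act \<sigma> \<delta> p q) n
      = coeff (\<Sum>i\<le>m. map_poly (act (coeff p i)) ((ore_shift \<sigma> \<delta> ^^ i) q)) n"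
    by (simp add: f_def coeff_sum coeff_map_poly additive.zero[OF addact] additive.sum[OF addact]
        coeff_ore_shift_power add)
qed

text \<open>Raising each index of \<open>p\<close> by one adds one application of
  \<open>ore_shift\<close>, which can be performed first; the new constant coefficient
  \<open>0\<close> acts as zero.\<close>

lemma ore_action_pCons_0:
  assumes "has_operators act" "additive \<sigma>" "additive \<delta>"
  shows "ore_action act \<sigma> \<delta> (pCons 0 p) q = ore_action act \<sigma> \<delta> p (ore_shift \<sigma> \<delta> q)"
proof -
  have "map_poly (act 0) r = 0" for r
    using assms(1) by (intro poly_eqI) (simp add: coeff_map_poly has_operators_def)
  then show ?thesis
    by (simp add: ore_action_eq_shift[OF assms degree_pCons_le]
        ore_action_eq_shift[OF assms order.refl] sum.atMost_Suc_shift funpow_Suc_right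
        del: sum.atMost_Suc funpow.simps)
qed

lemma additive_ore_action_left:
  fixes act :: "'s::ab_group_add \<Rightarrow> 'g::ab_group_add \<Rightarrow> 'g"
  assumes "has_operators act" "additive \<sigma>" "additive \<delta>" and left: "\<And>g. additive (\<lambda>s. act s g)"
  shows "additive (\<lambda>p. ore_action act \<sigma> \<delta> p q)"
proof
  fix p r :: "'s poly"
  define m where "m = max (degree p) (degree r)"
  have "map_poly (act (s + t)) h = map_poly (act s) h + map_poly (act t) h" for s t h
  proof -
    have "act s 0 = 0" for s using assms(1) additive.zero by (auto simp: has_operators_def)
    then show ?thesis by (intro poly_eqI) (simp add: coeff_map_poly additive.add[OF left])
  qed
  moreover have "degree (p + r) \<le> m" "degree p \<le> m" "degree r \<le> m"
    by (auto simp: m_def degree_add_le_max)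
  ultimately show "ore_action act \<sigma> \<delta> (p + r) q = ore_action act \<sigma> \<delta> p q + ore_action act \<sigma> \<delta> r q"
    by (simp add: ore_action_eq_shift[OF assms(1-3)] sum.distrib)
qed

lemma ore_shift_ore_action:
  assumes BC: "has_operators BC" "\<And>c. additive (\<lambda>b. BC b c)"
    and B: "additive \<sigma>B" "additive \<delta>B" and C: "additive \<sigma>C" "additive \<delta>C"
    and der: "twisted_derivation BC \<sigma>B \<delta>B \<delta>C" and tw: "twisted BC \<sigma>B \<sigma>C"
  shows "ore_shift \<sigma>C \<delta>C (ore_action BC \<sigma>C \<delta>C v w)
    = ore_action BC \<sigma>C \<delta>C (ore_shift \<sigma>B \<delta>B v) w"
proof -
  let ?X = "ore_shift \<sigma>C \<delta>C"
  have BC0: "BC b 0 = 0" for b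
    using BC(1) additive.zero by (auto simp: has_operators_def)
  have addBC: "BC b (c + d) = BC b c + BC b d" for b c d
    using BC(1) additive.add by (auto simp: has_operators_def)
  \<comment> \<open>The Ore commutation rule \<open>x b = \<sigma>B(b) x + \<delta>B(b)\<close> as
    maps on polynomials: \<open>tw\<close> handles the part raised in degree, \<open>der\<close> the
    rest.\<close>
  have shift_map: "?X (map_poly (BC b) h)
      = map_poly (BC (\<sigma>B b)) (?X h) + map_poly (BC (\<delta>B b)) h" for b h
  proof (rule poly_eqI)
    fix n
    show "coeff (?X (map_poly (BC b) h)) n
        = coeff (map_poly (BC (\<sigma>B b)) (?X h) + map_poly (BC (\<delta>B b)) h) n"
      using der tw
      by (cases n) (simp_all add: coeff_ore_shift_0 coeff_ore_shift_Suc C coeff_map_poly BC0 addBC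
          twisted_derivation_def twisted_def add.assoc)
  qed
  \<comment> \<open>Leading coefficients may be killed, so both actions are expanded up to
    \<open>degree v\<close> instead of their own degrees.\<close>
  have deg: "degree (map_poly \<sigma>B v) \<le> degree v" "degree (map_poly \<delta>B v) \<le> degree v"
    by (rule degree_map_poly_additive_le, fact B)+
  have "?X (ore_action BC \<sigma>C \<delta>C v w)
      = (\<Sum>i\<le>degree v. map_poly (BC (\<sigma>B (coeff v i))) ((?X ^^ i) (?X w)))
        + (\<Sum>i\<le>degree v. map_poly (BC (\<delta>B (coeff v i))) ((?X ^^ i) w))"
    by (simp add: ore_action_eq_shift[OF BC(1) C order.refl] ore_shift_sum C shift_map sum.distrib
        funpow_swap1)
  also have "\<dots> = ore_action BC \<sigma>C \<delta>C (map_poly \<sigma>B v) (?X w)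
      + ore_action BC \<sigma>C \<delta>C (map_poly \<delta>B v) w"
    by (simp add: ore_action_eq_shift[OF BC(1) C deg(1)] ore_action_eq_shift[OF BC(1) C deg(2)]
        coeff_map_poly additive.zero[OF B(1)] additive.zero[OF B(2)])
  \<comment> \<open>The shift on \<open>w\<close> is absorbed as a factor \<open>x\<close> of the
    operator; additivity in the operator then merges the two summands.\<close>
  also have "\<dots> = ore_action BC \<sigma>C \<delta>C (ore_shift \<sigma>B \<delta>B v) w"
    by (simp add: ore_shift_def ore_action_pCons_0[OF BC(1) C]
        additive.add[OF additive_ore_action_left[OF BC(1) C BC(2)]])
  finally show ?thesis .
qed

text \<open>The operator \<open>a\<close> stands to the left of every power of the shift, so the
  associativity of the coefficient triple applies term by term.\<close>

lemma map_poly_ore_action: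
  assumes ops: "has_operators AB" "has_operators AC" "has_operators BC"
    and C: "additive \<sigma>C" "additive \<delta>C"
    and assoc: "associative_triple AB AC BC"
  shows "map_poly (AC a) (ore_action BC \<sigma>C \<delta>C v w)
    = ore_action BC \<sigma>C \<delta>C (map_poly (AB a) v) w"
proof -
  have add: "additive (AB a)" "additive (AC a)" "additive (BC b)" for b
    using ops by (simp_all add: has_operators_def)
  note zero = add[THEN additive.zero]
  have "map_poly (AC a) (map_poly (BC b) h) = map_poly (BC (AB a b)) h" for b h
    using assoc by (intro poly_eqI) (simp add: coeff_map_poly zero associative_triple_def)
  then show ?thesis
    by (simp add: ore_action_eq_shift[where p = v, OF ops(3) C order.refl]
        ore_action_eq_shift[OF ops(3) C degree_map_poly_additive_le[OF add(1)]]
        map_poly_sum[OF add(2)] coeff_map_poly zero)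
qed


theorem theorem27:
  fixes AB :: "'a::zero \<Rightarrow> 'b::ab_group_add \<Rightarrow> 'b"
    and AC :: "'a \<Rightarrow> 'c::ab_group_add \<Rightarrow> 'c"
    and BC :: "'b \<Rightarrow> 'c \<Rightarrow> 'c"
    and \<sigma>B \<delta>B :: "'b \<Rightarrow> 'b"
    and \<sigma>C \<delta>C :: "'c \<Rightarrow> 'c"
  assumes "has_operators AB"
    and "has_operators AC"
    and "has_operators BC"
    and BC_left_additive: "\<And>c. additive (\<lambda>b. BC b c)"
    and "additive \<sigma>B" and "additive \<delta>B"
    and "additive \<sigma>C" and "additive \<delta>C"
    and "associative_triple AB AC BC"
    and "twisted_derivation BC \<sigma>B \<delta>B \<delta>C"
    and "twisted BC \<sigma>B \<sigma>C"
  shows "associative_triple (ore_action AB \<sigma>B \<delta>B) (ore_action AC \<sigma>C \<delta>C) (ore_action BC \<sigma>C \<delta>C)"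
  unfolding associative_triple_def
proof (intro allI)
  fix u v w
  have shift_power: "(ore_shift \<sigma>C \<delta>C ^^ i) (ore_action BC \<sigma>C \<delta>C v w)
      = ore_action BC \<sigma>C \<delta>C ((ore_shift \<sigma>B \<delta>B ^^ i) v) w" for i
    by (induction i) (simp_all add: ore_shift_ore_action assms)
  \<comment> \<open>With \<open>X\<close> for either shift and \<open>u_i\<close> for the
    coefficients of \<open>u\<close>, the sum of \<open>u_i X^i (v w)\<close> becomes that of
    \<open>(u_i X^i v) w\<close>, which is \<open>(u v) w\<close> by additivity in the
    operator.\<close>
  show "ore_action BC \<sigma>C \<delta>C (ore_action AB \<sigma>B \<delta>B u v) w
      = ore_action AC \<sigma>C \<delta>C u (ore_action BC \<sigma>C \<delta>C v w)"
    using assms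
    by (simp add: ore_action_eq_shift[where act = AB, OF _ _ _ order.refl]
        ore_action_eq_shift[where act = AC, OF _ _ _ order.refl] shift_power
        map_poly_ore_action[where AB = AB]
        additive.sum[OF additive_ore_action_left[where act = BC]])
qed

end
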